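(* Let $(X_\theta,\mathcal{B},\mu,T)$ be the substitution dynamical system associated to a primitive substitution $\theta$ on a finite alphabet $\mathcal{A}$, with Perron–Frobenius eigenvalue $\lambda>1$. Suppose $f:\mathcal{A}\to\mathbb{C}$ is a left eigenfunction of the $\theta$-matrix $M$ with eigenvalue $\lambda_f$, $|\lambda_f|=1$. Then the following are equivalent. (i) The function $w\mapsto f(w_1)$ from $X_\theta$ to $\mathbb{C}$ is a coboundary. (ii) There exists $w\in X_\theta$ such that $\sup_N|S_f(w_{\le N})|<\infty$. (iii) There is a function $h:\mathcal{A}\to\mathbb{C}$ such that for all $(a,j)\in\mathcal{X}$, $$S_f(\theta(a)_{<j})=D_f+h(a)-\lambda_f^{-1}h(\theta(a)_j).$$ (iv) There is a function $h:\mathcal{A}\to\mathbb{C}$ such that both of the following hold: (a) for all $(a,j)\in\mathcal{X}$ with $1\le j<|\theta(a)|$, $\ f(\theta(a)_j)=\lambda_f^{-1}\bigl(h(\theta(a)_j)-h(\theta(a)_{j+1})\bigr)$; (b) for all $a\in\mathcal{A}$, $\ D_f+h(a)-\lambda_f^{-1}h(\theta(a)_1)=0$.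
   Context: $\mathcal{A}^*$ is the set of finite words over $\mathcal{A}$. A substitution is a map $\theta:\mathcal{A}\to\mathcal{A}^*$, extended to words by concatenation. The $\theta$-matrix $M$ has $M_{a,b}$ = number of occurrences of $a$ in $\theta(b)$; $\theta$ is primitive if some power $M^k$, $k>0$, has all entries positive; $\lambda$ is the Perron–Frobenius eigenvalue of $M$. For a word $w$, $w_j$ is its $j$-th letter and $w_{<k}=w_1\cdots w_{k-1}$ (empty for $k=1$); for $w\in\mathcal{A}^{\mathbb{Z}}$, $w_{\le N}=w_1\cdots w_N$. $S_f(a_1\cdots a_k)=f(a_1)+\cdots+f(a_k)$. A left eigenfunction is a nonzero $f$ with $\sum_a f(a)M_{a,b}=\lambda_f f(b)$ for all $b$. $X_\theta\subset\mathcal{A}^{\mathbb{Z}}$ (product topology) is the set of bi-infinite sequences all of whose finite subwords occur in $\theta^n(a)$ for some $n\ge0$, $a\in\mathcal{A}$; $T$ is the shift $(Tw)_n=w_{n+1}$; $(X_\theta,T)$ is minimal and uniquely ergodic with invariant measure $\mu$, and $\mathcal{B}$ is the Borel $\sigma$-algebra. A continuous $F:X_\theta\to\mathbb{C}$ is a coboundary if $F=g-g\circ T$ for some continuous $g:X_\theta\to\mathbb{C}$. $\mathcal{X}=\{(a,j):a\in\mathcal{A},1\le j\le|\theta(a)|\}$. Let $\rho,\sigma$ be positive right and left Perron–Frobenius eigenvectors of $M$ with $\sum_a\sigma(a)\rho(a)=1$; put $\hat\rho(b,k)=\rho(b)$, $\hat\sigma(b,k)=\lambda^{-1}\sigma(\theta(b)_k)$,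 and $$D_f=\sum_{(a,j)\in\mathcal{X}}\hat\sigma(a,j)\hat\rho(a,j)\,S_f(\theta(a)_{<j}).$$ *)

theory Defs
  imports "HOL-Probability.Probability" "HOL-Library.Sublist"
begin

section \<open>Substitutions and the Perron--Frobenius eigenvalue\<close>

definition subst_word :: "('a \<Rightarrow> 'a list) \<Rightarrow> 'a list \<Rightarrow> 'a list" where
  "subst_word \<theta> u = concat (map \<theta> u)"

definition subst_matrix :: "('a::finite \<Rightarrow> 'a list) \<Rightarrow> real^'a^'a" where
  "subst_matrix \<theta> = (\<chi> a b. real (count_list (\<theta> b) a))"

definition matrix_power :: "real^'a^'a \<Rightarrow> nat \<Rightarrow> real^'a^'a" where
  "matrix_power M k = (((**) M) ^^ k) (mat 1)"

definition primitive_subst :: "('a::finite \<Rightarrow> 'a list) \<Rightarrow> bool" where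
  "primitive_subst \<theta> \<longleftrightarrow> (\<exists>k>0. \<forall>a b. matrix_power (subst_matrix \<theta>) k $ a $ b > 0)"

definition complex_eigenvalue :: "real^'a^'a \<Rightarrow> complex \<Rightarrow> bool" where
  "complex_eigenvalue M z \<longleftrightarrow>
     (\<exists>v :: complex^'a. v \<noteq> 0 \<and> (\<chi> a b. complex_of_real (M $ a $ b)) *v v = z *s v)"

text \<open>At most one real number satisfies this for a given matrix.\<close>
definition perron_frobenius_eigenvalue :: "real^'a^'a \<Rightarrow> real \<Rightarrow> bool" where
  "perron_frobenius_eigenvalue M l \<longleftrightarrow>
     complex_eigenvalue M (complex_of_real l) \<and> (\<forall>z. complex_eigenvalue M z \<longrightarrow> cmod z \<le> l)"

definition left_eigenfunction :: "real^'a^'a \<Rightarrow> ('a::finite \<Rightarrow> complex) \<Rightarrow> complex \<Rightarrow> bool" where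
  "left_eigenfunction M f z \<longleftrightarrow>
     f \<noteq> (\<lambda>_. 0) \<and> (\<forall>b. (\<Sum>a\<in>UNIV. f a * complex_of_real (M $ a $ b)) = z * f b)"


section \<open>The substitution dynamical system\<close>

definition subst_shift :: "('a \<Rightarrow> 'a list) \<Rightarrow> (int \<Rightarrow> 'a) set" where
  "subst_shift \<theta> =
     {w. \<forall>i j. \<exists>n a. sublist (map w [i..j]) ((subst_word \<theta> ^^ n) [a])}"

definition shift :: "(int \<Rightarrow> 'a) \<Rightarrow> int \<Rightarrow> 'a" where
  "shift w = (\<lambda>n. w (n + 1))"

definition subst_topology :: "('a \<Rightarrow> 'a list) \<Rightarrow> (int \<Rightarrow> 'a) topology" where
  "subst_topology \<theta> =
     subtopology (product_topology (\<lambda>_. discrete_topology UNIV) UNIV) (subst_shift \<theta>)"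

definition invariant_measure :: "('a \<Rightarrow> 'a list) \<Rightarrow> (int \<Rightarrow> 'a) measure \<Rightarrow> bool" where
  "invariant_measure \<theta> \<mu> \<longleftrightarrow>
     prob_space \<mu> \<and> space \<mu> = subst_shift \<theta> \<and>
     sets \<mu> = sigma_sets (subst_shift \<theta>) {U. openin (subst_topology \<theta>) U} \<and>
     shift \<in> measurable \<mu> \<mu> \<and> distr \<mu> \<mu> shift = \<mu>"

definition coboundary :: "('a \<Rightarrow> 'a list) \<Rightarrow> ((int \<Rightarrow> 'a) \<Rightarrow> complex) \<Rightarrow> bool" where
  "coboundary \<theta> F \<longleftrightarrow>
     continuous_map (subst_topology \<theta>) euclidean F \<and>
     (\<exists>g. continuous_map (subst_topology \<theta>) euclidean g \<and>
          (\<forall>w\<in>subst_shift \<theta>. F w = g w - g (shift w)))"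


section \<open>Letters, prefixes and Birkhoff sums\<close>

text \<open>Positions in words are counted from 1, list indices from 0.\<close>

definition letter :: "'a list \<Rightarrow> nat \<Rightarrow> 'a" where
  "letter u j = u ! (j - 1)"

definition prefix_before :: "'a list \<Rightarrow> nat \<Rightarrow> 'a list" where
  "prefix_before u j = take (j - 1) u"

definition prefix_upto :: "(int \<Rightarrow> 'a) \<Rightarrow> nat \<Rightarrow> 'a list" where
  "prefix_upto w N = map w [1..int N]"

definition word_sum :: "('a \<Rightarrow> complex) \<Rightarrow> 'a list \<Rightarrow> complex" where
  "word_sum f u = sum_list (map f u)"

definition positions :: "('a \<Rightarrow> 'a list) \<Rightarrow> ('a \<times> nat) set" where
  "positions \<theta> = {(a, j). 1 \<le> j \<and> j \<le> length (\<theta> a)}"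

definition rho_hat :: "real^'a \<Rightarrow> 'a \<times> nat \<Rightarrow> real" where
  "rho_hat \<rho> = (\<lambda>(b, k). \<rho> $ b)"

definition sigma_hat :: "('a \<Rightarrow> 'a list) \<Rightarrow> real \<Rightarrow> real^'a \<Rightarrow> 'a \<times> nat \<Rightarrow> real" where
  "sigma_hat \<theta> l \<sigma> = (\<lambda>(b, k). inverse l * \<sigma> $ letter (\<theta> b) k)"

definition drift ::
    "('a::finite \<Rightarrow> 'a list) \<Rightarrow> real \<Rightarrow> real^'a \<Rightarrow> real^'a \<Rightarrow> ('a \<Rightarrow> complex) \<Rightarrow> complex" where
  "drift \<theta> l \<rho> \<sigma> f =
     (\<Sum>(a, j)\<in>positions \<theta>.
        complex_of_real (sigma_hat \<theta> l \<sigma> (a, j) * rho_hat \<rho> (a, j)) *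
        word_sum f (prefix_before (\<theta> a) j))"

end

theory Submission
  imports Defs
begin

text \<open>
  Every condition says that \<open>f\<close> is the gradient of a function of the current letter:
  \<open>f(b) = \<lambda>\<^sub>f\<^sup>-\<^sup>1 (h(b) - h(c))\<close> whenever the two-letter word \<open>bc\<close> occurs in the language
  of the substitution.

  The step with content is that bounded sums produce such an \<open>h\<close>. By uniform recurrence, a bound
  on the prefix sums of one point bounds the sums over all words of the language
  (\<open>word_sum_bounded_on_language\<close>). Let \<open>u\<close> be a return word: it starts with a letter \<open>a\<close>, and
  \<open>ua\<close> is in the language. For large \<open>n\<close>, primitivity gives \<open>\<theta>\<^sup>n(a) = p u a s\<close>. In \<open>\<theta>\<^sup>n(ua)\<close>, the
  word from just after the first \<open>p\<close> up to the end of the \<open>u\<close> in the last block \<open>\<theta>\<^sup>n(a)\<close> is again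
  a return word to \<open>a\<close>, and its sum is \<open>(1 + \<lambda>\<^sub>f\<^sup>n) S\<^sub>f(u)\<close>. As \<open>|\<lambda>\<^sub>f| = 1\<close>, there are arbitrarily
  large \<open>n\<close> for which \<open>\<lambda>\<^sub>f\<^sup>n\<close> is close to 1, so a non-zero \<open>S\<^sub>f(u)\<close> could be multiplied by at least
  3/2 again and again, contradicting the bound (\<open>word_sum_return_word_zero\<close>). Hence the sum of a
  point \<open>w\<close> up to position \<open>i\<close> depends only on the letter at the next position, and this function
  of the letter, times \<open>-\<lambda>\<^sub>f\<close>, is \<open>h\<close>.

  Applying the gradient relation along \<open>\<theta>(a)\<close> and comparing \<open>S\<^sub>f(\<theta>(a)) = \<lambda>\<^sub>f f(a)\<close> on both sides
  shows that \<open>\<lambda>\<^sub>f\<^sup>-\<^sup>1 h(\<theta>(a)\<^sub>1) - h(a)\<close> is a constant \<open>E\<close>, so (iii) holds with \<open>E\<close> in place of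
  \<open>D\<^sub>f\<close>. The weights \<open>\<sigma>\<close>-hat times \<open>\<rho>\<close>-hat in \<open>D\<^sub>f\<close> form a probability on the
  positions \<open>(a, j)\<close> under which both \<open>a\<close> and \<open>\<theta>(a)\<^sub>j\<close> have the law \<open>\<sigma>\<rho>\<close>. Adding a constant to
  \<open>h\<close> so that its \<open>\<sigma>\<rho>\<close>-mean vanishes therefore forces \<open>E = D\<^sub>f\<close>.

  In the other direction, (iii) gives the gradient relation inside each \<open>\<theta>(a)\<close>, and the eigenvalue
  equation carries it from \<open>ab\<close> across the junction of \<open>\<theta>(a)\<close> and \<open>\<theta>(b)\<close>, hence to the whole
  language (\<open>cohomological_imp_language_potential\<close>); then \<open>w \<mapsto> \<lambda>\<^sub>f\<^sup>-\<^sup>1 h(w\<^sub>1)\<close> is a transfer function.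
  A coboundary has bounded sums because its transfer function is continuous on a compact space.
\<close>

section \<open>Iterating a substitution on words\<close>

abbreviation subst_iter :: "('a \<Rightarrow> 'a list) \<Rightarrow> nat \<Rightarrow> 'a list \<Rightarrow> 'a list" where
  "subst_iter \<theta> n \<equiv> subst_word \<theta> ^^ n"

definition subst_language :: "('a \<Rightarrow> 'a list) \<Rightarrow> 'a list set" where
  "subst_language \<theta> = {u. \<exists>n a. sublist u (subst_iter \<theta> n [a])}"

lemma subst_iter_Nil [simp]: "subst_iter \<theta> n [] = []"
  by (induction n) (auto simp: subst_word_def)

lemma subst_iter_append: "subst_iter \<theta> n (u @ v) = subst_iter \<theta> n u @ subst_iter \<theta> n v"
  by (induction n) (auto simp: subst_word_def)

lemma subst_iter_eq_concat: "subst_iter \<theta> n u = concat (map (\<lambda>c. subst_iter \<theta> n [c]) u)"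
proof (induction u)
  case (Cons c u)
  then show ?case
    using subst_iter_append[of n \<theta> "[c]" u] by simp
qed simp

lemma subst_iter_add: "subst_iter \<theta> (m + n) u = subst_iter \<theta> m (subst_iter \<theta> n u)"
  by (simp add: funpow_add)

lemma sublist_subst_iter_mono:
  assumes "sublist u v"
  shows "sublist (subst_iter \<theta> n u) (subst_iter \<theta> n v)"
proof -
  obtain p s where "v = p @ u @ s"
    using assms by (auto simp: sublist_def)
  then show ?thesis
    by (simp add: subst_iter_append)
qed

lemma sublist_subst_iter_if_mem:
  "c \<in> set v \<Longrightarrow> sublist (subst_iter \<theta> n [c]) (subst_iter \<theta> n v)"
  by (metis append_Cons append_Nil in_set_conv_decomp sublist_appendI sublist_subst_iter_mono)

lemma subst_language_sublist:
  "u \<in> subst_language \<theta> \<Longrightarrow> sublist v u \<Longrightarrow> v \<in> subst_language \<theta>"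
  unfolding subst_language_def by (blast intro: sublist_order.order_trans)

lemma subst_iter_in_language:
  assumes "u \<in> subst_language \<theta>"
  shows "subst_iter \<theta> n u \<in> subst_language \<theta>"
proof -
  obtain m a where "sublist u (subst_iter \<theta> m [a])"
    using assms by (auto simp: subst_language_def)
  then have "sublist (subst_iter \<theta> n u) (subst_iter \<theta> (n + m) [a])"
    by (simp add: subst_iter_add sublist_subst_iter_mono)
  then show ?thesis
    by (auto simp: subst_language_def)
qed

lemma subst_word_in_language:
  "u \<in> subst_language \<theta> \<Longrightarrow> subst_word \<theta> u \<in> subst_language \<theta>"
  using subst_iter_in_language[of u \<theta> 1] by simp


section \<open>Letter counts and primitivity\<close>

lemma sum_list_eq_sum_count:
  fixes g :: "'a::finite \<Rightarrow> 'b::comm_semiring_1"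
  shows "sum_list (map g u) = (\<Sum>a\<in>UNIV. g a * of_nat (count_list u a))"
proof (induction u)
  case (Cons c u)
  have "(\<Sum>a\<in>UNIV. g a * of_nat (count_list (c # u) a))
      = (\<Sum>a\<in>UNIV. (if c = a then g a else 0) + g a * of_nat (count_list u a))"
    by (intro sum.cong) (auto simp: algebra_simps)
  also have "\<dots> = g c + (\<Sum>a\<in>UNIV. g a * of_nat (count_list u a))"
    by (simp add: sum.distrib)
  finally show ?case
    using Cons by simp
qed simp

lemma count_list_subst_word:
  fixes \<theta> :: "'a::finite \<Rightarrow> 'a list"
  shows "count_list (subst_word \<theta> u) a = (\<Sum>c\<in>UNIV. count_list (\<theta> c) a * count_list u c)"
proof -
  have "count_list (subst_word \<theta> u) a = sum_list (map (\<lambda>c. count_list (\<theta> c) a) u)"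
    by (induction u) (auto simp: subst_word_def)
  then show ?thesis
    by (simp add: sum_list_eq_sum_count)
qed

lemma matrix_power_subst_matrix:
  "matrix_power (subst_matrix \<theta>) k $ a $ b = real (count_list (subst_iter \<theta> k [b]) a)"
proof (induction k arbitrary: a)
  case 0
  show ?case by (auto simp: matrix_power_def mat_def)
next
  case (Suc k)
  then show ?case
    by (simp add: matrix_power_def matrix_matrix_mult_def count_list_subst_word)
      (simp add: subst_matrix_def)
qed

lemma primitive_subst_nonempty:
  fixes \<theta> :: "'a::finite \<Rightarrow> 'a list"
  assumes "primitive_subst \<theta>"
  shows "\<theta> b \<noteq> []"
proof
  assume empty: "\<theta> b = []"
  obtain k where k: "k > 0" "\<And>a. matrix_power (subst_matrix \<theta>) k $ a $ b > 0"
    using assms by (auto simp: primitive_subst_def)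
  obtain m where m: "k = Suc m"
    using k(1) gr0_implies_Suc by blast
  have "subst_iter \<theta> k [b] = []"
    unfolding m funpow_Suc_right by (simp add: subst_word_def empty)
  then show False
    using k(2)[of b] by (simp add: matrix_power_subst_matrix)
qed

lemma primitive_subst_all_letters:
  fixes \<theta> :: "'a::finite \<Rightarrow> 'a list"
  assumes "primitive_subst \<theta>"
  obtains K where "\<And>n a b. n \<ge> K \<Longrightarrow> a \<in> set (subst_iter \<theta> n [b])"
proof -
  obtain K where K: "\<And>a b. matrix_power (subst_matrix \<theta>) K $ a $ b > 0"
    using assms by (auto simp: primitive_subst_def)
  have base: "a \<in> set (subst_iter \<theta> K [b])" for a b
    using K[of a b] by (cases "a \<in> set (subst_iter \<theta> K [b])") (simp_all add: matrix_power_subst_matrix)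
  \<comment> \<open>No image is empty, so a further application of \<open>\<theta>\<close> inside keeps every letter present.\<close>
  have "\<forall>a b. a \<in> set (subst_iter \<theta> (K + d) [b])" for d
  proof (induction d)
    case (Suc d)
    show ?case
    proof (intro allI)
      fix a b
      obtain c v where cv: "\<theta> b = c # v"
        using primitive_subst_nonempty[OF assms] by (meson neq_Nil_conv)
      have "subst_iter \<theta> (K + Suc d) [b] = subst_iter \<theta> (K + d) (\<theta> b)"
        by (simp add: funpow_Suc_right subst_word_def del: funpow.simps)
      moreover have "set (subst_iter \<theta> (K + d) [c]) \<subseteq> set (subst_iter \<theta> (K + d) (\<theta> b))"
        by (intro set_mono_sublist sublist_subst_iter_if_mem) (simp add: cv)
      ultimately show "a \<in> set (subst_iter \<theta> (K + Suc d) [b])"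
        using Suc by auto
    qed
  qed (use base in simp)
  then show ?thesis
    using that by (metis le_iff_add)
qed

lemma primitive_subst_word_occurs:
  fixes \<theta> :: "'a::finite \<Rightarrow> 'a list"
  assumes "primitive_subst \<theta>" and "u \<in> subst_language \<theta>"
  obtains m where "\<And>n b. n \<ge> m \<Longrightarrow> sublist u (subst_iter \<theta> n [b])"
proof -
  obtain K where K: "\<And>n a b. n \<ge> K \<Longrightarrow> a \<in> set (subst_iter \<theta> n [b])"
    using primitive_subst_all_letters[OF assms(1)] by blast
  obtain m a where u: "sublist u (subst_iter \<theta> m [a])"
    using assms(2) by (auto simp: subst_language_def)
  have "sublist u (subst_iter \<theta> n [b])" if "n \<ge> m + K" for n b
  proof -
    have "subst_iter \<theta> n [b] = subst_iter \<theta> m (subst_iter \<theta> (n - m) [b])"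
      using that by (simp flip: subst_iter_add)
    moreover have "a \<in> set (subst_iter \<theta> (n - m) [b])"
      using that by (intro K) simp
    ultimately have "sublist (subst_iter \<theta> m [a]) (subst_iter \<theta> n [b])"
      by (simp add: sublist_subst_iter_if_mem)
    with u show ?thesis
      by (rule sublist_order.order_trans)
  qed
  then show ?thesis
    using that by blast
qed


section \<open>Uniform recurrence\<close>

text \<open>A window longer than twice the largest block, starting inside some block, contains the whole
  of the next one.\<close>

lemma sublist_concat_contains_block:
  assumes "sublist v (concat (map B xs))" and "\<And>x. length (B x) \<le> R" and "2 * R < length v"
  obtains x where "sublist (B x) v"
  using assms(1,3)
proof (induction xs arbitrary: thesis)
  case Nil
  then show ?case by simp
next
  case (Cons x xs)
  have "\<not> sublist v (B x)"
    using sublist_length_le[of v "B x"] assms(2)[of x] Cons.prems(3) by auto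
  moreover have ?case if "sublist v (concat (map B xs))"
    using that Cons by blast
  moreover have ?case
    if v: "v = v1 @ v2" "suffix v1 (B x)" "prefix v2 (concat (map B xs))" for v1 v2
  proof -
    have "length v1 \<le> R"
      using suffix_length_le[OF v(2)] assms(2)[of x] by simp
    then have len: "R < length v2"
      using Cons.prems(3) v(1) by simp
    then obtain y ys where ys: "xs = y # ys"
      using v(3) by (cases xs) auto
    have "prefix (B y) v2"
      using v(3) assms(2)[of y] len by (intro prefix_length_prefix[of "B y" "concat (map B xs)" v2]) (simp_all add: ys)
    then have "sublist (B y) v"
      unfolding v(1) by (auto simp: prefix_def)
    then show ?thesis
      using Cons.prems(1) by blast
  qed
  ultimately show ?case
    using Cons.prems(2) by (auto simp: sublist_append)
qed

lemma length_prefix_upto [simp]: "length (prefix_upto w N) = N"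
  by (simp add: prefix_upto_def)

lemma prefix_upto_append:
  "i \<le> j \<Longrightarrow> prefix_upto w j = prefix_upto w i @ map w [int i + 1..int j]"
  unfolding prefix_upto_def map_append[symmetric]
  by (cases "i = 0") (auto simp flip: upto_split2)

lemma prefix_upto_Suc: "prefix_upto w (Suc i) = prefix_upto w i @ [w (int i + 1)]"
  using prefix_upto_append[of i "Suc i" w] by (simp add: add.commute)

lemma prefix_of_prefix_upto:
  assumes "prefix p (prefix_upto w N)"
  shows "prefix_upto w (length p) = p"
proof -
  have "length p \<le> N"
    using prefix_length_le[OF assms] by simp
  then have "prefix (prefix_upto w (length p)) (prefix_upto w N)"
    by (simp add: prefix_upto_append)
  then show ?thesis
    using assms by (metis length_prefix_upto prefix_length_prefix prefix_order.antisym order_refl)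
qed

lemma subst_shift_language: "w \<in> subst_shift \<theta> \<Longrightarrow> map w [i..j] \<in> subst_language \<theta>"
  by (simp add: subst_shift_def subst_language_def)

text \<open>The word \<open>u\<close> lies in every block \<open>\<theta>\<^sup>m(x)\<close> for some \<open>m\<close>. A window of \<open>w\<close> longer than any two
  such blocks comes from some \<open>\<theta>\<^sup>n(c)\<close>, which is a concatenation of these blocks provided that
  \<open>n \<ge> m\<close>; this is why the length bound \<open>R\<close> is taken over all exponents up to \<open>m\<close>.\<close>

lemma language_word_in_right_half:
  fixes \<theta> :: "'a::finite \<Rightarrow> 'a list"
  assumes "primitive_subst \<theta>" and "w \<in> subst_shift \<theta>" and "u \<in> subst_language \<theta>"
  obtains N where "sublist u (prefix_upto w N)"
proof -
  obtain m where m: "\<And>n b. n \<ge> m \<Longrightarrow> sublist u (subst_iter \<theta> n [b])"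
    using primitive_subst_word_occurs[OF assms(1,3)] by blast
  define R where "R = Max ((\<lambda>(n, c). length (subst_iter \<theta> n [c])) ` ({..m} \<times> UNIV))"
  have R: "length (subst_iter \<theta> n [c]) \<le> R" if "n \<le> m" for n c
    unfolding R_def using that by (intro Max_ge) auto
  define v where "v = prefix_upto w (2 * R + 1)"
  have "v \<in> subst_language \<theta>"
    unfolding v_def prefix_upto_def by (rule subst_shift_language[OF assms(2)])
  then obtain n c where v: "sublist v (subst_iter \<theta> n [c])"
    by (auto simp: subst_language_def)
  have "n > m"
  proof (rule ccontr)
    assume "\<not> n > m"
    then have "length (subst_iter \<theta> n [c]) \<le> R"
      by (intro R) simp
    then show False
      using sublist_length_le[OF v] by (simp add: v_def)
  qed
  then have "subst_iter \<theta> n [c] = subst_iter \<theta> m (subst_iter \<theta> (n - m) [c])"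
    by (simp flip: subst_iter_add)
  also have "\<dots> = concat (map (\<lambda>x. subst_iter \<theta> m [x]) (subst_iter \<theta> (n - m) [c]))"
    by (rule subst_iter_eq_concat)
  finally have "sublist v (concat (map (\<lambda>x. subst_iter \<theta> m [x]) (subst_iter \<theta> (n - m) [c])))"
    using v by simp
  then obtain x where "sublist (subst_iter \<theta> m [x]) v"
    by (rule sublist_concat_contains_block[where R = R]) (auto simp: R v_def)
  then show ?thesis
    using that m[of m x] sublist_order.order_trans unfolding v_def by blast
qed


section \<open>Birkhoff sums over return words\<close>

lemma word_sum_Nil [simp]: "word_sum f [] = 0"
  and word_sum_Cons [simp]: "word_sum f (a # u) = f a + word_sum f u"
  and word_sum_append [simp]: "word_sum f (u @ v) = word_sum f u + word_sum f v"
  by (simp_all add: word_sum_def)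

lemma left_eigenfunction_word_sum:
  assumes "left_eigenfunction (subst_matrix \<theta>) f z"
  shows "word_sum f (\<theta> b) = z * f b"
  using assms
  by (simp add: left_eigenfunction_def word_sum_def sum_list_eq_sum_count subst_matrix_def)

lemma word_sum_subst_iter:
  assumes "left_eigenfunction (subst_matrix \<theta>) f z"
  shows "word_sum f (subst_iter \<theta> n u) = z ^ n * word_sum f u"
proof -
  have step: "word_sum f (subst_word \<theta> v) = z * word_sum f v" for v
    by (induction v)
      (auto simp: subst_word_def left_eigenfunction_word_sum[OF assms] algebra_simps)
  show ?thesis
    by (induction n) (auto simp: step)
qed

lemma word_sum_bounded_on_language:
  fixes \<theta> :: "'a::finite \<Rightarrow> 'a list"
  assumes "primitive_subst \<theta>" and "w \<in> subst_shift \<theta>" and "u \<in> subst_language \<theta>"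
    and C: "\<And>N. cmod (word_sum f (prefix_upto w N)) \<le> C"
  shows "cmod (word_sum f u) \<le> 2 * C"
proof -
  obtain N where "sublist u (prefix_upto w N)"
    using language_word_in_right_half[OF assms(1-3)] by blast
  then obtain p s where pus: "prefix_upto w N = p @ u @ s"
    by (auto simp: sublist_def)
  have "prefix_upto w (length p) = p" "prefix_upto w (length (p @ u)) = p @ u"
    by (rule prefix_of_prefix_upto[of _ w N]; simp add: pus)+
  then have "cmod (word_sum f p) \<le> C" "cmod (word_sum f (p @ u)) \<le> C"
    using C[of "length p"] C[of "length (p @ u)"] by simp_all
  moreover have "cmod (word_sum f u) \<le> cmod (word_sum f (p @ u)) + cmod (word_sum f p)"
    using norm_triangle_ineq4[of "word_sum f (p @ u)" "word_sum f p"] by simp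
  ultimately show ?thesis
    by linarith
qed

text \<open>The powers of \<open>z\<^sup>m\<^sup>+\<^sup>1\<close> accumulate on the unit circle, and the quotient of two close powers
  is a power close to 1.\<close>

lemma unit_power_near_one:
  fixes z :: complex
  assumes "cmod z = 1"
  obtains n where "n \<ge> m" and "cmod (1 + z ^ n) \<ge> 3 / 2"
proof -
  \<comment> \<open>The step \<open>m + 1\<close> makes every difference of exponents exceed \<open>m\<close>.\<close>
  define Z where "Z i = z ^ (Suc m * i)" for i
  have "range Z \<subseteq> sphere 0 1"
    using assms by (auto simp: Z_def norm_power)
  then obtain x r where r: "strict_mono (r :: nat \<Rightarrow> nat)" "(Z \<circ> r) \<longlonglongrightarrow> x"
    using compact_sphere[of "0::complex" 1] unfolding compact_def by (metis rangeI subsetD)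
  then have "Cauchy (Z \<circ> r)"
    using LIMSEQ_imp_Cauchy by blast
  then obtain M where "\<And>i j. i \<ge> M \<Longrightarrow> j \<ge> M \<Longrightarrow> dist (Z (r i)) (Z (r j)) < 1 / 2"
    unfolding Cauchy_def by (metis comp_apply half_gt_zero zero_less_one)
  then have close: "dist (Z (r (Suc M))) (Z (r M)) < 1 / 2"
    by simp
  have lt: "r M < r (Suc M)"
    using r(1) by (simp add: strict_mono_def)
  define n where "n = Suc m * (r (Suc M) - r M)"
  have "Suc m * r (Suc M) = Suc m * r M + n"
    using lt unfolding n_def distrib_left[symmetric] by simp
  then have "Z (r (Suc M)) = Z (r M) * z ^ n"
    by (simp only: Z_def power_add)
  then have "Z (r (Suc M)) - Z (r M) = Z (r M) * (z ^ n - 1)"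
    by (simp add: algebra_simps)
  moreover have "cmod (Z (r M)) = 1"
    using assms by (simp add: Z_def norm_power)
  ultimately have "cmod (z ^ n - 1) < 1 / 2"
    using close by (simp add: dist_norm norm_mult)
  then have "cmod (1 + z ^ n) \<ge> 3 / 2"
    using norm_triangle_ineq4[of "1 + z ^ n" "z ^ n - 1"] by simp
  moreover have "Suc m * 1 \<le> n"
    unfolding n_def using lt by (intro mult_le_mono2) simp
  then have "n \<ge> m"
    by simp
  ultimately show ?thesis
    using that by blast
qed

text \<open>Writing \<open>\<theta>\<^sup>n(a) = p u a s\<close>, a return word is cut out of \<open>\<theta>\<^sup>n(ua)\<close> between the occurrence of
  \<open>u\<close> in its first block and the end of the occurrence of \<open>u\<close> in its last block. Compared with
  \<open>\<theta>\<^sup>n(u)\<close> it loses the prefix \<open>p\<close> and gains \<open>p u\<close> at the end, so its sum is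
  \<open>z\<^sup>n S\<^sub>f(u) + S\<^sub>f(u)\<close>.\<close>

lemma longer_return_word:
  fixes \<theta> :: "'a::finite \<Rightarrow> 'a list"
  assumes prim: "primitive_subst \<theta>"
    and eig: "left_eigenfunction (subst_matrix \<theta>) f z" and "cmod z = 1"
    and u: "u @ [a] \<in> subst_language \<theta>" "u \<noteq> []" "hd u = a"
  obtains v where "v @ [a] \<in> subst_language \<theta>" "v \<noteq> []" "hd v = a"
    "cmod (word_sum f v) \<ge> 3 / 2 * cmod (word_sum f u)"
proof -
  obtain m where m: "\<And>n b. n \<ge> m \<Longrightarrow> sublist (u @ [a]) (subst_iter \<theta> n [b])"
    using primitive_subst_word_occurs[OF prim u(1)] by blast
  obtain n where n: "n \<ge> m" "cmod (1 + z ^ n) \<ge> 3 / 2"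
    using unit_power_near_one[OF \<open>cmod z = 1\<close>] by blast
  obtain p s where ps: "subst_iter \<theta> n [a] = p @ u @ [a] @ s"
    using m[OF n(1), of a] by (auto simp: sublist_def)
  obtain t where t: "u = [a] @ t"
    using u(2,3) by (cases u) auto
  define v where "v = u @ [a] @ s @ subst_iter \<theta> n t @ p @ u"
  have split: "subst_iter \<theta> n u = p @ u @ [a] @ s @ subst_iter \<theta> n t"
    unfolding t subst_iter_append ps by (simp add: t)
  have "subst_iter \<theta> n (u @ [a]) = p @ (v @ [a]) @ s"
    unfolding subst_iter_append by (simp add: split ps v_def)
  then have "v @ [a] \<in> subst_language \<theta>"
    using subst_iter_in_language[OF u(1), of n] subst_language_sublist
    by (metis sublist_appendI)
  moreover have "word_sum f v = (1 + z ^ n) * word_sum f u"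
  proof -
    have "word_sum f v = word_sum f (subst_iter \<theta> n u) + word_sum f u"
      by (simp add: split v_def)
    then show ?thesis
      by (simp add: word_sum_subst_iter[OF eig] algebra_simps)
  qed
  then have "cmod (word_sum f v) \<ge> 3 / 2 * cmod (word_sum f u)"
    using mult_right_mono[OF n(2), of "cmod (word_sum f u)"] by (simp add: norm_mult)
  ultimately show ?thesis
    using that[of v] u by (simp add: v_def)
qed

lemma word_sum_return_word_zero:
  fixes \<theta> :: "'a::finite \<Rightarrow> 'a list"
  assumes prim: "primitive_subst \<theta>"
    and eig: "left_eigenfunction (subst_matrix \<theta>) f z" and "cmod z = 1"
    and bound: "\<And>u. u \<in> subst_language \<theta> \<Longrightarrow> cmod (word_sum f u) \<le> B"
    and u: "u @ [a] \<in> subst_language \<theta>" "u \<noteq> []" "hd u = a"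
  shows "word_sum f u = 0"
proof (rule ccontr)
  assume nz: "word_sum f u \<noteq> 0"
  have grow: "\<exists>v. v @ [a] \<in> subst_language \<theta> \<and> v \<noteq> [] \<and> hd v = a \<and>
           cmod (word_sum f v) \<ge> (3 / 2) ^ k * cmod (word_sum f u)" for k
  proof (induction k)
    case 0
    show ?case using u by auto
  next
    case (Suc k)
    then obtain v where v: "v @ [a] \<in> subst_language \<theta>" "v \<noteq> []" "hd v = a"
      "cmod (word_sum f v) \<ge> (3 / 2) ^ k * cmod (word_sum f u)"
      by blast
    obtain v' where "v' @ [a] \<in> subst_language \<theta>" "v' \<noteq> []" "hd v' = a"
      "cmod (word_sum f v') \<ge> 3 / 2 * cmod (word_sum f v)"
      using longer_return_word[OF prim eig \<open>cmod z = 1\<close> v(1-3)] by blast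
    then show ?case
      using v(4) by (intro exI[of _ v']) auto
  qed
  obtain k where "B / cmod (word_sum f u) < (3 / 2) ^ k"
    using real_arch_pow[of "3 / 2" "B / cmod (word_sum f u)"] by auto
  then have "B < (3 / 2) ^ k * cmod (word_sum f u)"
    using nz by (simp add: field_simps)
  moreover obtain v where "v @ [a] \<in> subst_language \<theta>"
    "cmod (word_sum f v) \<ge> (3 / 2) ^ k * cmod (word_sum f u)"
    using grow by blast
  moreover have "v \<in> subst_language \<theta>"
    using calculation(2) subst_language_sublist sublist_append_rightI by blast
  ultimately show False
    using bound[of v] by linarith
qed


section \<open>Potentials\<close>

definition potential_edge :: "('a \<Rightarrow> complex) \<Rightarrow> complex \<Rightarrow> ('a \<Rightarrow> complex) \<Rightarrow> 'a \<Rightarrow> 'a \<Rightarrow> bool" where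
  "potential_edge f z h b c \<longleftrightarrow> f b = inverse z * (h b - h c)"

lemma word_sum_butlast_potential:
  assumes "successively (potential_edge f z h) u" and "u \<noteq> []"
  shows "word_sum f (butlast u) = inverse z * (h (hd u) - h (last u))"
  using assms
  by (induction u rule: induct_list012)
    (auto simp: potential_edge_def algebra_simps)

text \<open>Between two occurrences of the same letter in \<open>w\<close> stands a return word, so the sum before an
  occurrence is determined by the letter. All two-letter words of the language occur in the right
  half of \<open>w\<close>, where these sums live.\<close>

lemma bounded_sums_potential:
  fixes \<theta> :: "'a::finite \<Rightarrow> 'a list"
  assumes prim: "primitive_subst \<theta>"
    and eig: "left_eigenfunction (subst_matrix \<theta>) f z" and z: "cmod z = 1"
    and w: "w \<in> subst_shift \<theta>"
    and bdd: "bdd_above (range (\<lambda>N. cmod (word_sum f (prefix_upto w N))))"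
  obtains h where "\<And>b c. [b, c] \<in> subst_language \<theta> \<Longrightarrow> potential_edge f z h b c"
proof -
  define P where "P i = word_sum f (prefix_upto w i)" for i
  obtain C where C: "\<And>N. cmod (P N) \<le> C"
    using bdd by (auto simp: bdd_above_def P_def)
  have bound: "cmod (word_sum f u) \<le> 2 * C" if "u \<in> subst_language \<theta>" for u
    using word_sum_bounded_on_language[OF prim w that, of f C] C by (simp add: P_def)
  have return_eq: "P i = P j" if "i < j" and same: "w (int i + 1) = w (int j + 1)" for i j
  proof -
    define u where "u = map w [int i + 1..int j]"
    have "u @ [w (int j + 1)] = map w [int i + 1..int j + 1]"
      using \<open>i < j\<close> upto_rec2[of "int i + 1" "int j + 1"] by (simp add: u_def)
    then have "u @ [w (int j + 1)] \<in> subst_language \<theta>"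
      using subst_shift_language[OF w] by simp
    moreover have "u \<noteq> []" "hd u = w (int j + 1)"
      using \<open>i < j\<close> same by (simp_all add: u_def upto_rec1)
    ultimately have "word_sum f u = 0"
      by (intro word_sum_return_word_zero[OF prim eig z bound])
    then show ?thesis
      using \<open>i < j\<close> by (simp add: P_def u_def prefix_upto_append[of i j])
  qed
  have P_eq: "P i = P j" if "w (int i + 1) = w (int j + 1)" for i j
  proof (cases i j rule: linorder_cases)
    case less
    with that show ?thesis by (intro return_eq)
  next
    case greater
    with that show ?thesis by (intro return_eq[symmetric]) simp_all
  qed simp
  define h where "h b = - z * P (SOME i. w (int i + 1) = b)" for b
  have h: "h (w (int i + 1)) = - z * P i" for i
  proof -
    have "w (int (SOME j. w (int j + 1) = w (int i + 1)) + 1) = w (int i + 1)"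
      by (rule someI[of "\<lambda>j. w (int j + 1) = w (int i + 1)"]) simp
    from P_eq[OF this] show ?thesis
      by (simp add: h_def)
  qed
  have "potential_edge f z h b c" if bc_lang: "[b, c] \<in> subst_language \<theta>" for b c
  proof -
    obtain N where "sublist [b, c] (prefix_upto w N)"
      using language_word_in_right_half[OF prim w bc_lang] by blast
    then obtain p s where ps: "prefix_upto w N = p @ [b, c] @ s"
      by (auto simp: sublist_def)
    define i where "i = length p"
    have "prefix_upto w i = p" "prefix_upto w (Suc i) = p @ [b]"
      "prefix_upto w (Suc (Suc i)) = p @ [b, c]"
      using prefix_of_prefix_upto[of p w N] prefix_of_prefix_upto[of "p @ [b]" w N]
        prefix_of_prefix_upto[of "p @ [b, c]" w N]
      by (simp_all add: ps i_def)
    then have bc: "b = w (int i + 1)" "c = w (int (Suc i) + 1)"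
      by (simp_all add: prefix_upto_Suc)
    have "P (Suc i) = P i + f b"
      by (simp add: P_def prefix_upto_Suc bc)
    moreover have "z \<noteq> 0"
      using z by auto
    ultimately show ?thesis
      unfolding potential_edge_def using h[of i] h[of "Suc i"] by (simp add: bc field_simps)
  qed
  then show ?thesis
    using that by blast
qed

lemma successively_if_pairs_in_language:
  assumes "\<And>b c. [b, c] \<in> subst_language \<theta> \<Longrightarrow> R b c" and "u \<in> subst_language \<theta>"
  shows "successively R u"
  using assms(2)
proof (induction u rule: induct_list012)
  case (3 b c u)
  have "sublist [b, c] (b # c # u)" "sublist (c # u) (b # c # u)"
    using sublist_append_rightI[of "[b, c]" u] sublist_append_leftI[of "c # u" "[b]"] by simp_all
  then show ?case
    using 3 assms(1) subst_language_sublist by fastforce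
qed auto

text \<open>If \<open>ab\<close> is in the language, \<open>S\<^sub>f(\<theta>(a))\<close> equals \<open>z\<^sup>-\<^sup>1 (h(\<theta>(a)\<^sub>1) - h(\<theta>(b)\<^sub>1))\<close> by the potential
  and \<open>z f(a) = h(a) - h(b)\<close> by the eigenvalue equation. So \<open>z\<^sup>-\<^sup>1 h(\<theta>(a)\<^sub>1) - h(a)\<close> does not change
  along a point, and every letter occurs there.\<close>

lemma potential_constant:
  fixes \<theta> :: "'a::finite \<Rightarrow> 'a list"
  assumes prim: "primitive_subst \<theta>"
    and eig: "left_eigenfunction (subst_matrix \<theta>) f z" and z: "z \<noteq> 0"
    and w: "w \<in> subst_shift \<theta>"
    and pot: "\<And>b c. [b, c] \<in> subst_language \<theta> \<Longrightarrow> potential_edge f z h b c"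
  obtains E where "\<And>a. E = inverse z * h (hd (\<theta> a)) - h a"
proof -
  define e where "e a = inverse z * h (hd (\<theta> a)) - h a" for a
  have edge: "e a = e b" if ab: "[a, b] \<in> subst_language \<theta>" for a b
  proof -
    obtain c v where cv: "\<theta> b = c # v"
      using primitive_subst_nonempty[OF prim] by (meson neq_Nil_conv)
    have "subst_word \<theta> [a, b] = (\<theta> a @ [c]) @ v"
      by (simp add: subst_word_def cv)
    then have "\<theta> a @ [c] \<in> subst_language \<theta>"
      using subst_word_in_language[OF ab] subst_language_sublist by (metis sublist_append_rightI)
    then have "successively (potential_edge f z h) (\<theta> a @ [c])"
      by (intro successively_if_pairs_in_language[OF pot])
    from word_sum_butlast_potential[OF this] have "word_sum f (\<theta> a) = inverse z * (h (hd (\<theta> a)) - h c)"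
      using primitive_subst_nonempty[OF prim, of a] by simp
    moreover have "word_sum f (\<theta> a) = h a - h b"
      using pot[OF ab] z by (simp add: left_eigenfunction_word_sum[OF eig] potential_edge_def)
    ultimately show ?thesis
      by (simp add: e_def cv algebra_simps)
  qed
  have along: "e (w (int i + 1)) = e (w 1)" for i
  proof (induction i)
    case (Suc i)
    have "[w (int i + 1), w (int i + 2)] = map w [int i + 1..int i + 2]"
      by (simp add: upto_rec1 add.commute)
    then have "[w (int i + 1), w (int i + 2)] \<in> subst_language \<theta>"
      using subst_shift_language[OF w] by metis
    moreover have "int (Suc i) + 1 = int i + 2"
      by simp
    ultimately show ?case
      using edge Suc by metis
  qed simp
  have "e a = e (w 1)" for a
  proof -
    have "[a] \<in> subst_language \<theta>"
      unfolding subst_language_def by (intro CollectI exI[of _ 0] exI[of _ a]) simp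
    then obtain N where "sublist [a] (prefix_upto w N)"
      using language_word_in_right_half[OF prim w] by blast
    then obtain p s where ps: "prefix_upto w N = p @ [a] @ s"
      by (auto simp: sublist_def)
    have "prefix_upto w (length p) = p" "prefix_upto w (Suc (length p)) = p @ [a]"
      using prefix_of_prefix_upto[of p w N] prefix_of_prefix_upto[of "p @ [a]" w N]
      by (simp_all add: ps)
    then have "a = w (int (length p) + 1)"
      by (simp add: prefix_upto_Suc)
    then show ?thesis
      using along by simp
  qed
  then have "e (w 1) = inverse z * h (hd (\<theta> a)) - h a" for a
    by (metis e_def)
  then show ?thesis
    using that by blast
qed


section \<open>The drift as an average\<close>

lemma positions_eq_Sigma: "positions \<theta> = Sigma UNIV (\<lambda>a. {1..length (\<theta> a)})"
  by (auto simp: positions_def)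

lemma sum_letters: "(\<Sum>j = 1..length u. g (letter u j)) = sum_list (map g u)"
proof -
  have "(\<Sum>j = 1..length u. g (letter u j)) = (\<Sum>i<length u. g (u ! i))"
    by (rule sum.reindex_bij_witness[of _ Suc "\<lambda>j. j - 1"]) (auto simp: letter_def)
  then show ?thesis
    by (simp add: sum_list_sum_nth atLeast0LessThan)
qed

text \<open>The next two lemmas identify the two marginals of the weights in the drift. The letter
  \<open>\<theta>(a)\<^sub>j\<close> has law \<open>\<sigma>\<rho>\<close> because \<open>\<rho>\<close> is a right eigenvector, and \<open>a\<close> has the same law because
  \<open>\<sigma>\<close> is a left eigenvector.\<close>

lemma weighted_sum_letters:
  fixes \<theta> :: "'a::finite \<Rightarrow> 'a list" and g :: "'a \<Rightarrow> complex"
  assumes "l \<noteq> 0" and "subst_matrix \<theta> *v \<rho> = l *s \<rho>"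
  shows "(\<Sum>(a, j)\<in>positions \<theta>.
      complex_of_real (sigma_hat \<theta> l \<sigma> (a, j) * rho_hat \<rho> (a, j)) * g (letter (\<theta> a) j))
    = (\<Sum>b\<in>UNIV. complex_of_real (\<sigma> $ b * \<rho> $ b) * g b)" (is "?L = _")
proof -
  define G where "G b = complex_of_real (\<sigma> $ b) * g b" for b
  have eig: "(\<Sum>a\<in>UNIV. real (count_list (\<theta> a) b) * \<rho> $ a) = l * \<rho> $ b" for b
    using assms(2) by (simp add: vec_eq_iff matrix_vector_mult_def subst_matrix_def)
  have "?L = (\<Sum>a\<in>UNIV. \<Sum>j = 1..length (\<theta> a).
      inverse l * \<rho> $ a * G (letter (\<theta> a) j))"
    unfolding positions_eq_Sigma
    by (subst sum.Sigma[symmetric])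
      (auto simp: sigma_hat_def rho_hat_def G_def mult_ac intro!: sum.cong)
  also have "\<dots> = (\<Sum>a\<in>UNIV. inverse l * \<rho> $ a * (\<Sum>b\<in>UNIV. G b * count_list (\<theta> a) b))"
    by (simp only: sum_letters sum_list_eq_sum_count sum_distrib_left[symmetric])
  also have "\<dots> = (\<Sum>b\<in>UNIV. \<Sum>a\<in>UNIV. inverse l * \<rho> $ a * (G b * count_list (\<theta> a) b))"
    unfolding sum_distrib_left by (rule sum.swap)
  also have "\<dots> = (\<Sum>b\<in>UNIV. inverse l * G b *
      complex_of_real (\<Sum>a\<in>UNIV. real (count_list (\<theta> a) b) * \<rho> $ a))"
    by (simp add: sum_distrib_left mult_ac)
  also have "\<dots> = (\<Sum>b\<in>UNIV. complex_of_real (\<sigma> $ b * \<rho> $ b) * g b)"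
    unfolding eig using assms(1) by (intro sum.cong) (auto simp: G_def field_simps)
  finally show ?thesis .
qed

lemma weighted_sum_blocks:
  fixes \<theta> :: "'a::finite \<Rightarrow> 'a list" and g :: "'a \<Rightarrow> complex"
  assumes "l \<noteq> 0" and "\<sigma> v* subst_matrix \<theta> = l *s \<sigma>"
  shows "(\<Sum>(a, j)\<in>positions \<theta>.
      complex_of_real (sigma_hat \<theta> l \<sigma> (a, j) * rho_hat \<rho> (a, j)) * g a)
    = (\<Sum>a\<in>UNIV. complex_of_real (\<sigma> $ a * \<rho> $ a) * g a)" (is "?L = _")
proof -
  have eig: "sum_list (map (\<lambda>b. complex_of_real (\<sigma> $ b)) (\<theta> a)) = l * \<sigma> $ a" for a
  proof -
    have "sum_list (map (\<lambda>b. \<sigma> $ b) (\<theta> a)) = l * \<sigma> $ a"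
      using assms(2)
      by (simp add: vec_eq_iff vector_matrix_mult_def subst_matrix_def sum_list_eq_sum_count mult.commute)
    then have "complex_of_real (sum_list (map (\<lambda>b. \<sigma> $ b) (\<theta> a))) = complex_of_real (l * \<sigma> $ a)"
      by (rule arg_cong)
    then show ?thesis
      by (simp add: sum_list_eq_sum_count)
  qed
  have "?L = (\<Sum>a\<in>UNIV. \<Sum>j = 1..length (\<theta> a).
      inverse l * \<rho> $ a * g a * \<sigma> $ letter (\<theta> a) j)"
    unfolding positions_eq_Sigma
    by (subst sum.Sigma[symmetric])
      (auto simp: sigma_hat_def rho_hat_def mult_ac intro!: sum.cong)
  also have "\<dots> = (\<Sum>a\<in>UNIV. inverse l * \<rho> $ a * g a * (l * \<sigma> $ a))"
    by (simp only: eig sum_letters[where g = "\<lambda>b. complex_of_real (\<sigma> $ b)"]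
        sum_distrib_left[symmetric])
  also have "\<dots> = (\<Sum>a\<in>UNIV. complex_of_real (\<sigma> $ a * \<rho> $ a) * g a)"
    using assms(1) by (intro sum.cong) (auto simp: field_simps)
  finally show ?thesis .
qed


section \<open>Compactness of the substitution space\<close>

lemma topspace_subst_topology [simp]: "topspace (subst_topology \<theta>) = subst_shift \<theta>"
  by (simp add: subst_topology_def)

text \<open>Membership in the shift space fails already on a finite window, hence on a cylinder.\<close>

lemma closedin_subst_shift:
  "closedin (product_topology (\<lambda>_. discrete_topology UNIV) UNIV) (subst_shift \<theta>)"
proof -
  let ?X = "product_topology (\<lambda>_::int. discrete_topology (UNIV :: 'a set)) UNIV"
  have "openin ?X (- subst_shift \<theta>)"
  proof (subst openin_subopen, intro ballI)
    fix w assume "w \<in> - subst_shift \<theta>"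
    then obtain i j where ij: "map w [i..j] \<notin> subst_language \<theta>"
      by (auto simp: subst_shift_def subst_language_def)
    define T where "T = (\<Pi>\<^sub>E k\<in>UNIV. if k \<in> {i..j} then {w k} else UNIV)"
    have "openin ?X T"
      unfolding T_def by (intro product_topology_basis) (auto intro: finite_subset[of _ "{i..j}"])
    moreover have "w \<in> T"
      by (auto simp: T_def)
    moreover have "T \<subseteq> - subst_shift \<theta>"
    proof
      fix x assume x: "x \<in> T"
      have "x k = w k" if "k \<in> {i..j}" for k
      proof -
        have "x k \<in> (if k \<in> {i..j} then {w k} else UNIV)"
          using x unfolding T_def by (rule PiE_mem) simp
        with that show ?thesis
          by simp
      qed
      then have "map x [i..j] = map w [i..j]"
        by (intro map_cong) auto
      then show "x \<in> - subst_shift \<theta>"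
        using ij subst_shift_language by (metis ComplI)
    qed
    ultimately show "\<exists>T. openin ?X T \<and> w \<in> T \<and> T \<subseteq> - subst_shift \<theta>"
      by blast
  qed
  then show ?thesis
    by (simp add: closedin_def Compl_eq_Diff_UNIV)
qed

lemma compact_space_subst_topology: "compact_space (subst_topology (\<theta> :: 'a::finite \<Rightarrow> 'a list))"
  unfolding subst_topology_def
  by (intro compact_space_subtopology closedin_compact_space closedin_subst_shift)
    (simp add: compact_space_product_topology compact_space_discrete_topology)

lemma continuous_map_letter:
  fixes g :: "'a \<Rightarrow> complex"
  shows "continuous_map (subst_topology \<theta>) euclidean (\<lambda>w. g (w k))"
proof -
  have "continuous_map (subst_topology \<theta>) (discrete_topology UNIV) (\<lambda>w. w k)"
    unfolding subst_topology_def
    by (intro continuous_map_from_subtopology continuous_map_product_projection) simp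
  then have "continuous_map (subst_topology \<theta>) euclidean (g \<circ> (\<lambda>w. w k))"
    by (rule continuous_map_compose) simp
  then show ?thesis
    by (simp add: comp_def)
qed

lemma shift_in_subst_shift:
  assumes "w \<in> subst_shift \<theta>"
  shows "shift w \<in> subst_shift \<theta>"
proof -
  have "map (shift w) [i..j] = map w [i + 1..j + 1]" for i j
    by (rule nth_equalityI) (auto simp: shift_def algebra_simps)
  then show ?thesis
    using assms by (simp add: subst_shift_def)
qed

lemma coboundary_bounded_sums:
  fixes \<theta> :: "'a::finite \<Rightarrow> 'a list"
  assumes "coboundary \<theta> (\<lambda>w. f (w 1))" and w: "w \<in> subst_shift \<theta>"
  shows "bdd_above (range (\<lambda>N. cmod (word_sum f (prefix_upto w N))))"
proof -
  obtain g where g: "continuous_map (subst_topology \<theta>) euclidean g"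
    "\<And>w. w \<in> subst_shift \<theta> \<Longrightarrow> f (w 1) = g w - g (shift w)"
    using assms(1) by (auto simp: coboundary_def)
  have "compactin (subst_topology \<theta>) (subst_shift \<theta>)"
    using compact_space_subst_topology[of \<theta>] by (simp add: compact_space_def)
  from image_compactin[OF this g(1)] have "bounded (g ` subst_shift \<theta>)"
    by (simp add: compact_imp_bounded)
  then obtain B where B: "\<And>w. w \<in> subst_shift \<theta> \<Longrightarrow> cmod (g w) \<le> B"
    by (auto simp: bounded_iff)
  define x where "x N = (\<lambda>k. w (k + int N))" for N
  have x_Suc: "x (Suc N) = shift (x N)" for N
    by (auto simp: x_def shift_def algebra_simps)
  have orbit: "x N \<in> subst_shift \<theta> \<and> word_sum f (prefix_upto w N) = g w - g (x N)" for N
  proof (induction N)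
    case 0
    then show ?case using w by (simp add: prefix_upto_def x_def)
  next
    case (Suc N)
    have "f (w (int N + 1)) = g (x N) - g (x (Suc N))"
      using g(2)[of "x N"] Suc by (simp add: x_Suc) (simp add: x_def add.commute)
    then show ?case
      using Suc shift_in_subst_shift[of "x N" \<theta>] by (simp add: prefix_upto_Suc x_Suc)
  qed
  have "cmod (word_sum f (prefix_upto w N)) \<le> 2 * B" for N
    using orbit[of N] B[OF w] B[of "x N"]
      norm_triangle_ineq4[of "g w" "g (x N)"] by simp
  then show ?thesis
    by (auto simp: bdd_above_def)
qed


section \<open>From bounded sums to the cohomological equation and back\<close>

text \<open>A potential satisfies (iii) with some constant in place of the drift. Averaging over the
  positions gives that the drift is this constant plus \<open>(1 - z\<^sup>-\<^sup>1)\<close> times the \<open>\<sigma>\<rho>\<close>-mean of the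
  potential, and the mean can be normalised to zero.\<close>

lemma bounded_sums_imp_cohomological:
  fixes \<theta> :: "'a::finite \<Rightarrow> 'a list"
  assumes prim: "primitive_subst \<theta>" and l: "l \<noteq> 0"
    and \<rho>: "subst_matrix \<theta> *v \<rho> = l *s \<rho>" and \<sigma>: "\<sigma> v* subst_matrix \<theta> = l *s \<sigma>"
    and norm: "(\<Sum>a\<in>UNIV. \<sigma> $ a * \<rho> $ a) = 1"
    and eig: "left_eigenfunction (subst_matrix \<theta>) f z" and z: "cmod z = 1"
    and w: "w \<in> subst_shift \<theta>"
    and bdd: "bdd_above (range (\<lambda>N. cmod (word_sum f (prefix_upto w N))))"
  shows "\<exists>h. \<forall>(a, j)\<in>positions \<theta>. word_sum f (prefix_before (\<theta> a) j)
    = drift \<theta> l \<rho> \<sigma> f + h a - inverse z * h (letter (\<theta> a) j)"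
proof -
  obtain h0 where h0: "\<And>b c. [b, c] \<in> subst_language \<theta> \<Longrightarrow> potential_edge f z h0 b c"
    using bounded_sums_potential[OF prim eig z w bdd] by blast
  define avg where "avg g = (\<Sum>a\<in>UNIV. complex_of_real (\<sigma> $ a * \<rho> $ a) * g a)"
    for g :: "'a \<Rightarrow> complex"
  have avg_const: "avg (\<lambda>_. c) = c" for c
  proof -
    have "avg (\<lambda>_. c) = complex_of_real (\<Sum>a\<in>UNIV. \<sigma> $ a * \<rho> $ a) * c"
      by (simp only: avg_def sum_distrib_right of_real_sum)
    then show ?thesis
      using norm by simp
  qed
  \<comment> \<open>Mean zero, so that averaging (iii) over the positions leaves only the constant.\<close>
  define h where "h a = h0 a - avg h0" for a
  have avg_h: "avg h = 0"
  proof -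
    have "avg h = avg h0 - avg (\<lambda>_. avg h0)"
      by (simp add: avg_def h_def algebra_simps sum_subtractf)
    then show ?thesis
      by (simp add: avg_const)
  qed
  have h: "potential_edge f z h b c" if "[b, c] \<in> subst_language \<theta>" for b c
    using h0[OF that] by (simp add: potential_edge_def h_def)
  have "z \<noteq> 0"
    using z by auto
  then obtain E where E: "\<And>a. E = inverse z * h (hd (\<theta> a)) - h a"
    using potential_constant[OF prim eig _ w h] by blast
  have sums: "word_sum f (prefix_before (\<theta> a) j) = E + h a - inverse z * h (letter (\<theta> a) j)"
    if "(a, j) \<in> positions \<theta>" for a j
  proof -
    have j: "1 \<le> j" "j \<le> length (\<theta> a)"
      using that by (auto simp: positions_def)
    define u where "u = take j (\<theta> a)"
    have "sublist u (subst_iter \<theta> 1 [a])"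
      by (simp add: u_def subst_word_def sublist_take)
    then have "u \<in> subst_language \<theta>"
      unfolding subst_language_def by blast
    then have "successively (potential_edge f z h) u"
      by (intro successively_if_pairs_in_language[OF h])
    moreover have "u \<noteq> []"
      using j by (auto simp: u_def)
    ultimately have "word_sum f (butlast u) = inverse z * (h (hd u) - h (last u))"
      by (rule word_sum_butlast_potential)
    moreover have "butlast u = prefix_before (\<theta> a) j"
      using j by (simp add: u_def prefix_before_def butlast_take)
    moreover have "hd u = hd (\<theta> a)"
      using j by (simp add: u_def)
    moreover have "last u = letter (\<theta> a) j"
      using j \<open>u \<noteq> []\<close> by (simp add: last_conv_nth) (simp add: u_def letter_def min_absorb2)
    ultimately show ?thesis
      using E[of a] by (simp add: algebra_simps)
  qed
  have "drift \<theta> l \<rho> \<sigma> f = (\<Sum>(a, j)\<in>positions \<theta>.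
      complex_of_real (sigma_hat \<theta> l \<sigma> (a, j) * rho_hat \<rho> (a, j)) * (E + h a)
      - complex_of_real (sigma_hat \<theta> l \<sigma> (a, j) * rho_hat \<rho> (a, j))
        * (inverse z * h (letter (\<theta> a) j)))"
    unfolding drift_def by (intro sum.cong) (auto simp: sums algebra_simps)
  also have "\<dots> = (\<Sum>(a, j)\<in>positions \<theta>.
      complex_of_real (sigma_hat \<theta> l \<sigma> (a, j) * rho_hat \<rho> (a, j)) * (E + h a))
      - (\<Sum>(a, j)\<in>positions \<theta>.
      complex_of_real (sigma_hat \<theta> l \<sigma> (a, j) * rho_hat \<rho> (a, j))
        * (inverse z * h (letter (\<theta> a) j)))"
    by (simp add: case_prod_unfold sum_subtractf)
  also have "\<dots> = avg (\<lambda>a. E + h a) - avg (\<lambda>a. inverse z * h a)"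
    unfolding weighted_sum_letters[OF l \<rho>, of \<sigma> "\<lambda>b. inverse z * h b"]
      weighted_sum_blocks[OF l \<sigma>, of \<rho> "\<lambda>a. E + h a"] avg_def ..
  also have "avg (\<lambda>a. E + h a) = avg (\<lambda>_. E) + avg h"
    by (simp add: avg_def algebra_simps sum.distrib)
  also have "avg (\<lambda>a. inverse z * h a) = inverse z * avg h"
    by (simp add: avg_def sum_distrib_left mult_ac)
  finally have "drift \<theta> l \<rho> \<sigma> f = E"
    by (simp add: avg_h avg_const)
  then show ?thesis
    using sums by (intro exI[of _ h]) auto
qed

text \<open>Two functions of \<open>j\<close> agree exactly when they agree at \<open>j = 1\<close> and have the same
  increments.\<close>

lemma cohomological_iff_local:
  assumes "\<And>a. \<theta> a \<noteq> []"
  shows "(\<forall>(a, j)\<in>positions \<theta>.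
      word_sum f (prefix_before (\<theta> a) j) = D + h a - inverse z * h (letter (\<theta> a) j)) \<longleftrightarrow>
    (\<forall>(a, j)\<in>positions \<theta>. j < length (\<theta> a) \<longrightarrow>
         f (letter (\<theta> a) j) = inverse z * (h (letter (\<theta> a) j) - h (letter (\<theta> a) (j + 1)))) \<and>
      (\<forall>a. D + h a - inverse z * h (letter (\<theta> a) 1) = 0)"
proof -
  define P where "P a j = word_sum f (prefix_before (\<theta> a) j)" for a j
  define Q where "Q a j = D + h a - inverse z * h (letter (\<theta> a) j)" for a j
  have P1: "P a 1 = 0" for a
    by (simp add: P_def prefix_before_def)
  have P_Suc: "P a (j + 1) = P a j + f (letter (\<theta> a) j)" if "1 \<le> j" "j < length (\<theta> a)" for a j
  proof -
    obtain i where "j = Suc i"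
      using \<open>1 \<le> j\<close> by (cases j) auto
    then show ?thesis
      using that by (simp add: P_def prefix_before_def letter_def take_Suc_conv_app_nth)
  qed
  have "(\<forall>j. 1 \<le> j \<and> j \<le> length (\<theta> a) \<longrightarrow> P a j = Q a j) \<longleftrightarrow>
    (\<forall>j. 1 \<le> j \<and> j < length (\<theta> a) \<longrightarrow> f (letter (\<theta> a) j) = Q a (j + 1) - Q a j) \<and> Q a 1 = 0"
    (is "?A = ?B") for a
  proof
    assume A: ?A
    have "length (\<theta> a) \<ge> 1"
      using assms[of a] by (simp add: Suc_leI)
    then have "Q a 1 = 0"
      using A P1[of a] by auto
    moreover have "f (letter (\<theta> a) j) = Q a (j + 1) - Q a j" if "1 \<le> j" "j < length (\<theta> a)" for j
    proof -
      have "P a j = Q a j" "P a (j + 1) = Q a (j + 1)"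
        using A that by auto
      then show ?thesis
        using P_Suc[OF that] by simp
    qed
    ultimately show ?B
      by blast
  next
    assume B: ?B
    have "P a j = Q a j" if "1 \<le> j" "j \<le> length (\<theta> a)" for j
      using that
    proof (induction j rule: dec_induct)
      case base
      then show ?case using B P1 by simp
    next
      case (step j)
      then show ?case using B P_Suc[of j a] by simp
    qed
    then show ?A by blast
  qed
  then show ?thesis
    unfolding positions_def P_def Q_def by (auto simp: algebra_simps)
qed

text \<open>It suffices that \<open>\<theta>\<close> maps potential-compatible words to potential-compatible words. At the
  junction of \<open>\<theta>(a)\<close> and \<open>\<theta>(b)\<close> the value \<open>f\<close> of the last letter of \<open>\<theta>(a)\<close> is
  \<open>S\<^sub>f(\<theta>(a)) = z f(a) = h(a) - h(b)\<close> minus the sum over the rest of \<open>\<theta>(a)\<close>, and (iii) evaluates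
  that sum; the constant \<open>D\<close> cancels against (iii) for the first letter of \<open>\<theta>(b)\<close>.\<close>

lemma cohomological_imp_language_potential:
  fixes \<theta> :: "'a::finite \<Rightarrow> 'a list"
  assumes ne: "\<And>a. \<theta> a \<noteq> []"
    and eig: "left_eigenfunction (subst_matrix \<theta>) f z" and z: "z \<noteq> 0"
    and sums: "\<forall>(a, j)\<in>positions \<theta>.
      word_sum f (prefix_before (\<theta> a) j) = D + h a - inverse z * h (letter (\<theta> a) j)"
    and u: "u \<in> subst_language \<theta>"
  shows "successively (potential_edge f z h) u"
proof -
  have inner: "\<And>a j. 1 \<le> j \<Longrightarrow> j < length (\<theta> a) \<Longrightarrow>
      f (letter (\<theta> a) j) = inverse z * (h (letter (\<theta> a) j) - h (letter (\<theta> a) (j + 1)))"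
    and first: "\<And>a. D + h a - inverse z * h (letter (\<theta> a) 1) = 0"
    using sums cohomological_iff_local[where \<theta> = \<theta> and f = f and D = D and h = h and z = z, OF ne]
    by (auto simp: positions_def)
  \<comment> \<open>Letters are counted from 1 and list indices from 0, hence the shift by one.\<close>
  have block: "successively (potential_edge f z h) (\<theta> a)" for a
    unfolding successively_conv_nth potential_edge_def
    using inner[of "Suc _" a] by (auto simp: letter_def)
  have junction: "potential_edge f z h (last (\<theta> a)) (hd (\<theta> b))"
    if ab: "potential_edge f z h a b" for a b
  proof -
    have len: "1 \<le> length (\<theta> a)"
      using ne[of a] by (simp add: Suc_leI)
    then have "word_sum f (butlast (\<theta> a)) = D + h a - inverse z * h (last (\<theta> a))"
      using sums ne[of a]
      by (auto simp: positions_def prefix_before_def letter_def butlast_conv_take last_conv_nth)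
    moreover have "word_sum f (\<theta> a) = word_sum f (butlast (\<theta> a)) + f (last (\<theta> a))"
      using append_butlast_last_id[OF ne, of a] word_sum_append[of f "butlast (\<theta> a)" "[last (\<theta> a)]"]
      by simp
    moreover have "word_sum f (\<theta> a) = h a - h b"
      using ab z by (simp add: left_eigenfunction_word_sum[OF eig] potential_edge_def)
    moreover have "D + h b - inverse z * h (hd (\<theta> b)) = 0"
      using first[of b] ne[of b] by (simp add: letter_def hd_conv_nth)
    ultimately show ?thesis
      unfolding potential_edge_def by (simp add: algebra_simps)
  qed
  have step: "successively (potential_edge f z h) (subst_word \<theta> v)"
    if "successively (potential_edge f z h) v" for v
    using that
  proof (induction v rule: induct_list012)
    case (3 a b v)
    then have "potential_edge f z h (last (\<theta> a)) (hd (subst_word \<theta> (b # v)))"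
      using junction[of a b] ne[of b] by (simp add: subst_word_def)
    then show ?case
      using 3 block[of a] by (simp add: subst_word_def successively_append_iff)
  qed (auto simp: subst_word_def block)
  have iter: "successively (potential_edge f z h) (subst_iter \<theta> n [a])" for n a
    by (induction n) (auto simp: step)
  obtain n a p s where "subst_iter \<theta> n [a] = p @ u @ s"
    using u by (auto simp: subst_language_def sublist_def)
  then show ?thesis
    using iter[of n a] by (simp add: successively_append_iff)
qed

lemma cohomological_imp_coboundary:
  fixes \<theta> :: "'a::finite \<Rightarrow> 'a list"
  assumes "\<And>a. \<theta> a \<noteq> []"
    and "left_eigenfunction (subst_matrix \<theta>) f z" and "z \<noteq> 0"
    and "\<forall>(a, j)\<in>positions \<theta>.
      word_sum f (prefix_before (\<theta> a) j) = D + h a - inverse z * h (letter (\<theta> a) j)"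
  shows "coboundary \<theta> (\<lambda>w. f (w 1))"
  unfolding coboundary_def
proof (intro conjI exI[of _ "\<lambda>w. inverse z * h (w 1)"] ballI)
  show "continuous_map (subst_topology \<theta>) euclidean (\<lambda>w. f (w 1))"
    by (rule continuous_map_letter)
  show "continuous_map (subst_topology \<theta>) euclidean (\<lambda>w. inverse z * h (w 1))"
    by (rule continuous_map_letter)
  fix w assume "w \<in> subst_shift \<theta>"
  then have "map w [1..2] \<in> subst_language \<theta>"
    by (rule subst_shift_language)
  then have "successively (potential_edge f z h) (map w [1..2])"
    by (rule cohomological_imp_language_potential[OF assms])
  then show "f (w 1) = inverse z * h (w 1) - inverse z * h (shift w 1)"
    by (simp add: upto_rec1 potential_edge_def shift_def algebra_simps)
qed

theorem proposition3p1:
  fixes \<theta> :: "'a::finite \<Rightarrow> 'a list"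
    and \<mu> :: "(int \<Rightarrow> 'a) measure"
    and l :: real and \<rho> \<sigma> :: "real^'a"
    and f :: "'a \<Rightarrow> complex" and lf :: complex
  defines "M \<equiv> subst_matrix \<theta>"
  defines "D \<equiv> drift \<theta> l \<rho> \<sigma> f"
  assumes "primitive_subst \<theta>"
    and "invariant_measure \<theta> \<mu>"
    and "perron_frobenius_eigenvalue M l" and "l > 1"
    and "\<forall>a. \<rho> $ a > 0" and "M *v \<rho> = l *s \<rho>"
    and "\<forall>a. \<sigma> $ a > 0" and "\<sigma> v* M = l *s \<sigma>"
    and "(\<Sum>a\<in>UNIV. \<sigma> $ a * \<rho> $ a) = 1"
    and "left_eigenfunction M f lf" and "cmod lf = 1"
  defines "cond_i \<equiv> coboundary \<theta> (\<lambda>w. f (w 1))"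
  defines "cond_ii \<equiv> \<exists>w\<in>subst_shift \<theta>. bdd_above (range (\<lambda>N. cmod (word_sum f (prefix_upto w N))))"
  defines "cond_iii \<equiv> \<exists>h :: 'a \<Rightarrow> complex. \<forall>(a, j)\<in>positions \<theta>.
      word_sum f (prefix_before (\<theta> a) j) = D + h a - inverse lf * h (letter (\<theta> a) j)"
  defines "cond_iv \<equiv> \<exists>h :: 'a \<Rightarrow> complex.
      (\<forall>(a, j)\<in>positions \<theta>. j < length (\<theta> a) \<longrightarrow>
         f (letter (\<theta> a) j) = inverse lf * (h (letter (\<theta> a) j) - h (letter (\<theta> a) (j + 1)))) \<and>
      (\<forall>a. D + h a - inverse lf * h (letter (\<theta> a) 1) = 0)"
  shows "(cond_i \<longleftrightarrow> cond_ii) \<and> (cond_ii \<longleftrightarrow> cond_iii) \<and> (cond_iii \<longleftrightarrow> cond_iv)"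
proof -
  have ne: "\<theta> a \<noteq> []" for a
    by (rule primitive_subst_nonempty) fact
  have "lf \<noteq> 0"
    using \<open>cmod lf = 1\<close> by auto
  have eig: "left_eigenfunction (subst_matrix \<theta>) f lf"
    using \<open>left_eigenfunction M f lf\<close> by (simp add: M_def)
  have "prob_space \<mu>" "space \<mu> = subst_shift \<theta>"
    using \<open>invariant_measure \<theta> \<mu>\<close> by (auto simp: invariant_measure_def)
  then have "subst_shift \<theta> \<noteq> {}"
    using prob_space.not_empty by metis
  then obtain w where w: "w \<in> subst_shift \<theta>"
    by blast
  have "cond_i \<Longrightarrow> cond_ii"
    unfolding cond_i_def cond_ii_def by (rule bexI[OF _ w]) (rule coboundary_bounded_sums[OF _ w])
  moreover have "cond_iii" if bounded: "cond_ii"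
  proof -
    obtain w' where w': "w' \<in> subst_shift \<theta>"
      "bdd_above (range (\<lambda>N. cmod (word_sum f (prefix_upto w' N))))"
      using bounded unfolding cond_ii_def by blast
    have "l \<noteq> 0" "subst_matrix \<theta> *v \<rho> = l *s \<rho>" "\<sigma> v* subst_matrix \<theta> = l *s \<sigma>"
      using \<open>l > 1\<close> \<open>M *v \<rho> = l *s \<rho>\<close> \<open>\<sigma> v* M = l *s \<sigma>\<close> by (simp_all add: M_def)
    then show ?thesis
      unfolding cond_iii_def D_def
      by (rule bounded_sums_imp_cohomological[OF \<open>primitive_subst \<theta>\<close> _ _ _
            \<open>(\<Sum>a\<in>UNIV. \<sigma> $ a * \<rho> $ a) = 1\<close> eig \<open>cmod lf = 1\<close> w'])
  qed
  moreover have "cond_iii \<Longrightarrow> cond_i"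
    unfolding cond_iii_def cond_i_def
    by (elim exE) (rule cohomological_imp_coboundary[OF ne eig \<open>lf \<noteq> 0\<close>])
  moreover have "cond_iii \<longleftrightarrow> cond_iv"
    unfolding cond_iii_def cond_iv_def
    by (intro arg_cong[where f = Ex] ext cohomological_iff_local[OF ne])
  ultimately show ?thesis
    by blast
qed

end
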